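(* Let $G$ be a group with subgroups $Z\le K\le N$ such that $N\unlhd G$, $K\unlhd G$, $N$ is abelian, $G/N$ is abelian, $Z\le Z(G)$, and $N/K\le Z(G/K)$. Let $\mu:G/K\times G/K\to Z$ be a mapping with $\mu(xK,K)=1=\mu(K,xK)$ for all $x\in G$; write $\mu(x,y)$ for $\mu(xK,yK)$, and put $\delta(x,y)=\mu(x,y)\mu(y,x)^{-1}$. Let $Q=(G,* )$ be the loop given by $x*y=xy\,\mu(x,y)$. Assume that $\mu(xy,z)=\mu(x,z)\mu(y,z)$ and $\mu(x,yz)=\mu(x,y)\mu(x,z)$ for all $x,y,z\in G$ with $\{x,y,z\}\cap N\ne\emptyset$. Then $\mathrm{Inn}\,Q$ is abelian if and only if $$z^{yx}\,\delta([z,y],x)=z^{xy}\,\delta([z,x],y)\quad\text{for all }x,y,z\in G.$$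
   Context: In the group $G$: $y^x=x^{-1}yx$ and $[y,x]=y^{-1}y^x$. A loop is a set with a binary operation and two-sided neutral element such that $ax=b$, $ya=b$ are uniquely solvable for $x,y$. For a loop $Q$, let $L_x:y\mapsto x*y$ and $R_x:y\mapsto y*x$. The inner mapping group $\mathrm{Inn}\,Q$ is the permutation group of $Q$ generated by all $L_{y*x}^{-1}L_yL_x$, $R_{x*y}^{-1}R_yR_x$ and $R_x^{-1}L_x$, $x,y\in Q$. *)

theory Defs
  imports "HOL-Algebra.Algebra"
begin

section \<open>Groups\<close>

definition group_center :: "('a, 'b) monoid_scheme \<Rightarrow> 'a set"
  where "group_center G = {z \<in> carrier G. \<forall>x \<in> carrier G. z \<otimes>\<^bsub>G\<^esub> x = x \<otimes>\<^bsub>G\<^esub> z}"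

(* conjugate_by G y x is y^x, group_commutator G y x is [y,x]; several incompatible
   conventions are in use for both. *)
definition conjugate_by :: "('a, 'b) monoid_scheme \<Rightarrow> 'a \<Rightarrow> 'a \<Rightarrow> 'a"
  where "conjugate_by G y x = inv\<^bsub>G\<^esub> x \<otimes>\<^bsub>G\<^esub> y \<otimes>\<^bsub>G\<^esub> x"

definition group_commutator :: "('a, 'b) monoid_scheme \<Rightarrow> 'a \<Rightarrow> 'a \<Rightarrow> 'a"
  where "group_commutator G y x = inv\<^bsub>G\<^esub> y \<otimes>\<^bsub>G\<^esub> conjugate_by G y x"

section \<open>Loops and their inner mapping groups\<close>

locale loop =
  fixes Q :: "('a, 'b) monoid_scheme" (structure)
  assumes m_closed: "\<lbrakk>x \<in> carrier Q; y \<in> carrier Q\<rbrakk> \<Longrightarrow> x \<otimes> y \<in> carrier Q"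
    and one_closed: "\<one> \<in> carrier Q"
    and l_one: "x \<in> carrier Q \<Longrightarrow> \<one> \<otimes> x = x"
    and r_one: "x \<in> carrier Q \<Longrightarrow> x \<otimes> \<one> = x"
    and l_div: "\<lbrakk>a \<in> carrier Q; b \<in> carrier Q\<rbrakk> \<Longrightarrow> \<exists>!x. x \<in> carrier Q \<and> a \<otimes> x = b"
    and r_div: "\<lbrakk>a \<in> carrier Q; b \<in> carrier Q\<rbrakk> \<Longrightarrow> \<exists>!y. y \<in> carrier Q \<and> y \<otimes> a = b"

definition left_translation :: "('a, 'b) monoid_scheme \<Rightarrow> 'a \<Rightarrow> 'a \<Rightarrow> 'a"
  where "left_translation Q x = (\<lambda>y \<in> carrier Q. x \<otimes>\<^bsub>Q\<^esub> y)"

definition right_translation :: "('a, 'b) monoid_scheme \<Rightarrow> 'a \<Rightarrow> 'a \<Rightarrow> 'a"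
  where "right_translation Q x = (\<lambda>y \<in> carrier Q. y \<otimes>\<^bsub>Q\<^esub> x)"

(* Permutations act on the left and multiply by composition: L_y L_x maps z to y * (x * z). *)
definition inner_mapping_generators :: "('a, 'b) monoid_scheme \<Rightarrow> ('a \<Rightarrow> 'a) set"
  where "inner_mapping_generators Q =
    (let S = BijGroup (carrier Q); L = left_translation Q; R = right_translation Q in
      {inv\<^bsub>S\<^esub> L (y \<otimes>\<^bsub>Q\<^esub> x) \<otimes>\<^bsub>S\<^esub> L y \<otimes>\<^bsub>S\<^esub> L x | x y. x \<in> carrier Q \<and> y \<in> carrier Q} \<union>
      {inv\<^bsub>S\<^esub> R (x \<otimes>\<^bsub>Q\<^esub> y) \<otimes>\<^bsub>S\<^esub> R y \<otimes>\<^bsub>S\<^esub> R x | x y. x \<in> carrier Q \<and> y \<in> carrier Q} \<union>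
      {inv\<^bsub>S\<^esub> R x \<otimes>\<^bsub>S\<^esub> L x | x. x \<in> carrier Q})"

definition Inn :: "('a, 'b) monoid_scheme \<Rightarrow> ('a \<Rightarrow> 'a) monoid"
  where "Inn Q = subgroup_generated (BijGroup (carrier Q)) (inner_mapping_generators Q)"

lemma (in loop) left_translation_Bij:
  assumes "x \<in> carrier Q" shows "left_translation Q x \<in> Bij (carrier Q)"
proof -
  have "bij_betw (\<lambda>y. x \<otimes> y) (carrier Q) (carrier Q)"
    unfolding bij_betw_def inj_on_def image_def
    using m_closed[OF assms] l_div[OF assms] by (auto; metis)
  then show ?thesis
    unfolding Bij_def left_translation_def by simp
qed

lemma (in loop) right_translation_Bij:
  assumes "x \<in> carrier Q" shows "right_translation Q x \<in> Bij (carrier Q)"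
proof -
  have "bij_betw (\<lambda>y. y \<otimes> x) (carrier Q) (carrier Q)"
    unfolding bij_betw_def inj_on_def image_def
    using m_closed[OF _ assms] r_div[OF assms] by (auto; metis)
  then show ?thesis
    unfolding Bij_def right_translation_def by simp
qed

section \<open>Central modifications of a group\<close>

(* mu(x,y) = mu(xK,yK) *)
definition lift_cosets ::
    "('a, 'b) monoid_scheme \<Rightarrow> 'a set \<Rightarrow> ('a set \<Rightarrow> 'a set \<Rightarrow> 'a) \<Rightarrow> 'a \<Rightarrow> 'a \<Rightarrow> 'a"
  where "lift_cosets G K \<mu> x y = \<mu> (x <#\<^bsub>G\<^esub> K) (y <#\<^bsub>G\<^esub> K)"

(* delta(x,y) = mu(x,y) mu(y,x)^(-1) *)
definition lift_delta ::
    "('a, 'b) monoid_scheme \<Rightarrow> 'a set \<Rightarrow> ('a set \<Rightarrow> 'a set \<Rightarrow> 'a) \<Rightarrow> 'a \<Rightarrow> 'a \<Rightarrow> 'a"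
  where "lift_delta G K \<mu> x y =
    lift_cosets G K \<mu> x y \<otimes>\<^bsub>G\<^esub> inv\<^bsub>G\<^esub> lift_cosets G K \<mu> y x"

definition modified_loop ::
    "('a, 'b) monoid_scheme \<Rightarrow> 'a set \<Rightarrow> ('a set \<Rightarrow> 'a set \<Rightarrow> 'a) \<Rightarrow> 'a monoid"
  where "modified_loop G K \<mu> =
    \<lparr>carrier = carrier G,
     monoid.mult = (\<lambda>x y. x \<otimes>\<^bsub>G\<^esub> y \<otimes>\<^bsub>G\<^esub> lift_cosets G K \<mu> x y),
     one = \<one>\<^bsub>G\<^esub>\<rparr>"

lemma loop_modified_loop:
  fixes G (structure)
  assumes "group G" and Z: "subgroup Z G" "Z \<subseteq> K" and K: "K \<lhd> G"
    and cen: "Z \<subseteq> group_center G"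
    and mu: "\<And>A B. \<lbrakk>A \<in> carrier (G Mod K); B \<in> carrier (G Mod K)\<rbrakk> \<Longrightarrow> \<mu> A B \<in> Z"
    and mu1: "\<And>x. x \<in> carrier G \<Longrightarrow> \<mu> (x <# K) K = \<one> \<and> \<mu> K (x <# K) = \<one>"
  shows "loop (modified_loop G K \<mu>)"
proof -
  interpret group G by fact
  interpret K: normal K G by fact
  interpret Z: subgroup Z G by fact
  define m where "m = lift_cosets G K \<mu>"
  have coset: "x <# K \<in> carrier (G Mod K)" if "x \<in> carrier G" for x
    using that K.coset_eq by (auto simp: FactGroup_def RCOSETS_def)
  have mZ: "m x y \<in> Z" if "x \<in> carrier G" "y \<in> carrier G" for x y
    unfolding m_def lift_cosets_def using mu coset that by blast
  have mG: "m x y \<in> carrier G" if "x \<in> carrier G" "y \<in> carrier G" for x y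
    using mZ[OF that] by auto
  have comm: "z \<otimes> x = x \<otimes> z" if "z \<in> Z" "x \<in> carrier G" for x z
    using cen that by (auto simp: group_center_def)
  have cosetZ: "(x \<otimes> z) <# K = x <# K" if "x \<in> carrier G" "z \<in> Z" for x z
    using that Z K.subset lcos_m_assoc[of K x z]
    by (metis K.coset_eq K.is_subgroup Z.mem_carrier coset_join2 subsetD)
  have mr: "m x (y \<otimes> z) = m x y" "m (y \<otimes> z) x = m y x" if "y \<in> carrier G" "z \<in> Z" for x y z
    using cosetZ[OF that] by (simp_all add: m_def lift_cosets_def)
  have K1: "\<one> <# K = K"
    using K.coset_eq K.subset by (metis coset_mult_one one_closed)
  have m1: "m x \<one> = \<one>" "m \<one> x = \<one>" if "x \<in> carrier G" for x
    using mu1[OF that] K1 by (simp_all add: m_def lift_cosets_def)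
  have L: "\<exists>!x. x \<in> carrier G \<and> a \<otimes> x \<otimes> m a x = b" if a: "a \<in> carrier G" and b: "b \<in> carrier G" for a b
  proof -
    define c where "c = inv a \<otimes> b"
    have c: "c \<in> carrier G" "a \<otimes> c = b" using a b by (auto simp: c_def m_assoc[symmetric])
    let ?z = "m a c"
    have z: "?z \<in> Z" "inv ?z \<in> Z" "?z \<in> carrier G" using mZ[OF a c(1)] by auto
    show ?thesis
    proof (rule ex1I[of _ "c \<otimes> inv ?z"])
      show "c \<otimes> inv ?z \<in> carrier G \<and> a \<otimes> (c \<otimes> inv ?z) \<otimes> m a (c \<otimes> inv ?z) = b"
        using a c z by (simp add: mr m_assoc)
    next
      fix x assume x: "x \<in> carrier G \<and> a \<otimes> x \<otimes> m a x = b"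
      then have xm: "x \<otimes> m a x = c"
        using a by (auto simp: c_def m_assoc[symmetric] mG)
      then have "m a c = m a x" using mr(1)[of x "m a x" a] mZ[of a x] a x by auto
      then show "x = c \<otimes> inv ?z" using xm x c z by (metis inv_solve_right)
    qed
  qed
  have R: "\<exists>!y. y \<in> carrier G \<and> y \<otimes> a \<otimes> m y a = b" if a: "a \<in> carrier G" and b: "b \<in> carrier G" for a b
  proof -
    define c where "c = b \<otimes> inv a"
    have c: "c \<in> carrier G" "c \<otimes> a = b" using a b by (auto simp: c_def m_assoc)
    let ?z = "m c a"
    have z: "?z \<in> Z" "inv ?z \<in> Z" "?z \<in> carrier G" using mZ[OF c(1) a] by auto
    show ?thesis
    proof (rule ex1I[of _ "c \<otimes> inv ?z"])
      have "c \<otimes> inv ?z \<otimes> a \<otimes> ?z = c \<otimes> (inv ?z \<otimes> (a \<otimes> ?z))" using a c z by (simp add: m_assoc)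
      also have "\<dots> = c \<otimes> a" using a c z by (simp add: comm[OF z(1) a, symmetric] m_assoc[symmetric])
      finally show "c \<otimes> inv ?z \<in> carrier G \<and> c \<otimes> inv ?z \<otimes> a \<otimes> m (c \<otimes> inv ?z) a = b"
        using a c z by (simp add: mr)
    next
      fix y assume y: "y \<in> carrier G \<and> y \<otimes> a \<otimes> m y a = b"
      have mm: "m y a \<in> Z" "m y a \<in> carrier G" using y a mZ by auto
      have "y \<otimes> m y a \<otimes> a = b" using y a mm comm[OF mm(1) a] by (metis m_assoc)
      then have ym: "y \<otimes> m y a = c"
        using a b y mm by (metis c_def inv_solve_right m_closed)
      then have "m c a = m y a" using mr(2)[of y "m y a" a] mm y by auto
      then show "y = c \<otimes> inv ?z" using ym y c z by (metis inv_solve_right)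
    qed
  qed
  show ?thesis
    by unfold_locales
      (use L R m1 mG in \<open>simp_all add: modified_loop_def flip: m_def\<close>)
qed

end

theory Submission
  imports Defs
begin

text \<open>
  A group generated by a set is abelian as soon as the generators commute, so only the three
  families generating \<open>Inn Q\<close> have to be compared with each other.

  The multiplication of \<open>Q\<close> differs from that of \<open>G\<close> by factors in the central subgroup \<open>Z\<close>.
  Since \<open>G\<close> is associative, both \<open>L\<^bsub>y*x\<^esub>\<^sup>-\<^sup>1 L\<^sub>y L\<^sub>x\<close> and \<open>R\<^bsub>x*y\<^esub>\<^sup>-\<^sup>1 R\<^sub>y R\<^sub>x\<close> therefore
  have the form \<open>z \<mapsto> z c(z)\<close> with \<open>c(z) \<in> Z\<close>. Bimultiplicativity of \<open>\<mu>\<close> along \<open>N\<close> makes the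
  contributions of \<open>n \<in> N\<close> to \<open>c(zn)\<close> cancel, so that \<open>c\<close> is constant on cosets of \<open>N\<close>
  (\<open>left_inner_mapping_central_shift\<close>, \<open>right_inner_mapping_central_shift\<close>). Two such maps
  commute, because each moves its argument only within a coset of \<open>Z \<le> N\<close>.

  The remaining generator \<open>R\<^sub>u\<^sup>-\<^sup>1 L\<^sub>u\<close> with \<open>u = x\<^sup>-\<^sup>1\<close> is \<open>z \<mapsto> z\<^sup>x t(x,z)\<close> for some
  \<open>t(x,z) \<in> Z\<close> (\<open>middle_inner_mapping_inv\<close>). It moves \<open>z\<close> within its coset of \<open>N\<close>, as \<open>G/N\<close> is
  abelian, and hence commutes with the maps above. Thus everything depends on whether two maps
  of this last kind commute. Because \<open>N/K\<close> is central in \<open>G/K\<close> and \<open>\<mu>\<close> only sees cosets of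
  \<open>K\<close>, one has \<open>t(x,zn) = t(x,z) \<delta>(n,x)\<close> for \<open>n \<in> N\<close> (\<open>twist_mult_N\<close>). With
  \<open>z\<^sup>y = z [z,y]\<close> the composition of the map for \<open>y\<close> followed by the map for \<open>x\<close> becomes
  \<open>z \<mapsto> z\<^bsup>yx\<^esup> \<delta>([z,y],x) t(x,z) t(y,z)\<close>. The factor \<open>t(x,z) t(y,z)\<close> is symmetric in \<open>x\<close> and
  \<open>y\<close>, and what is left is the stated identity.
\<close>

section \<open>Commuting generators\<close>

lemma (in group) commutes_with_generate:
  assumes "S \<subseteq> carrier G" "h \<in> carrier G" "\<And>s. s \<in> S \<Longrightarrow> s \<otimes> h = h \<otimes> s"
    and "g \<in> generate G S"
  shows "g \<otimes> h = h \<otimes> g"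
  using assms(4)
proof induction
  case (inv s)
  then have s: "s \<in> carrier G" "s \<otimes> h = h \<otimes> s" using assms by auto
  then show ?case
    using assms(2) by (metis inv_closed inv_solve_left inv_solve_right m_assoc m_closed)
next
  case (eng g1 g2)
  then have "g1 \<in> carrier G" "g2 \<in> carrier G"
    using generate_in_carrier assms(1) by blast+
  then show ?case using eng.IH assms(2) by (metis m_assoc)
qed (use assms in auto)

lemma (in group) comm_group_subgroup_generated_iff:
  assumes "S \<subseteq> carrier G"
  shows "comm_group (subgroup_generated G S) \<longleftrightarrow> (\<forall>a \<in> S. \<forall>b \<in> S. a \<otimes> b = b \<otimes> a)"
proof
  assume c: "comm_group (subgroup_generated G S)"
  show "\<forall>a \<in> S. \<forall>b \<in> S. a \<otimes> b = b \<otimes> a"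
  proof (intro ballI)
    fix a b assume "a \<in> S" "b \<in> S"
    then have "a \<in> carrier (subgroup_generated G S)" "b \<in> carrier (subgroup_generated G S)"
      using assms by (auto simp: carrier_subgroup_generated intro: generate.incl)
    then show "a \<otimes> b = b \<otimes> a"
      using comm_groupE(4)[OF c, of a b] by simp
  qed
next
  assume S: "\<forall>a \<in> S. \<forall>b \<in> S. a \<otimes> b = b \<otimes> a"
  have gen: "carrier (subgroup_generated G S) = generate G S"
    using assms by (simp add: carrier_subgroup_generated Int_absorb1)
  have "g \<otimes> h = h \<otimes> g" if g: "g \<in> generate G S" and h: "h \<in> generate G S" for g h
  proof (rule commutes_with_generate[OF assms _ _ g])
    show "h \<in> carrier G" using generate_in_carrier[OF assms h] .
    show "s \<otimes> h = h \<otimes> s" if "s \<in> S" for s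
      using commutes_with_generate[OF assms _ _ h, of s] S that assms by auto
  qed
  then show "comm_group (subgroup_generated G S)"
    by (intro group.group_comm_groupI[OF group_subgroup_generated]) (simp add: gen)
qed

section \<open>Inner mappings of a loop\<close>

lemma BijGroup_mult_apply:
  "\<lbrakk>f \<in> Bij A; g \<in> Bij A; z \<in> A\<rbrakk> \<Longrightarrow> (f \<otimes>\<^bsub>BijGroup A\<^esub> g) z = f (g z)"
  by (simp add: BijGroup_def compose_eq)

lemma BijGroup_commute_iff:
  assumes "f \<in> Bij A" "g \<in> Bij A"
  shows "f \<otimes>\<^bsub>BijGroup A\<^esub> g = g \<otimes>\<^bsub>BijGroup A\<^esub> f \<longleftrightarrow> (\<forall>z \<in> A. f (g z) = g (f z))"
proof -
  have "compose A f g = compose A g f \<longleftrightarrow> (\<forall>z \<in> A. compose A f g z = compose A g f z)"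
    by (metis compose_extensional extensionalityI)
  with assms show ?thesis by (simp add: BijGroup_def compose_eq)
qed

text \<open>A quotient \<open>f\<^sup>-\<^sup>1 g\<close> is determined by what \<open>f\<close> does to its values; in this way the
  inner mappings are handled below without computing inverses of translations.\<close>

lemma BijGroup_inv_mult:
  assumes "f \<in> Bij A" "g \<in> Bij A"
  shows "inv\<^bsub>BijGroup A\<^esub> f \<otimes>\<^bsub>BijGroup A\<^esub> g \<in> Bij A"
    and "z \<in> A \<Longrightarrow> f ((inv\<^bsub>BijGroup A\<^esub> f \<otimes>\<^bsub>BijGroup A\<^esub> g) z) = g z"
proof -
  interpret B: group "BijGroup A" by (rule group_BijGroup)
  have carr: "carrier (BijGroup A) = Bij A" by (simp add: BijGroup_def)
  show mem: "inv\<^bsub>BijGroup A\<^esub> f \<otimes>\<^bsub>BijGroup A\<^esub> g \<in> Bij A"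
    using assms B.m_closed B.inv_closed by (simp add: carr)
  assume "z \<in> A"
  moreover have "f \<otimes>\<^bsub>BijGroup A\<^esub> (inv\<^bsub>BijGroup A\<^esub> f \<otimes>\<^bsub>BijGroup A\<^esub> g) = g"
    using assms[folded carr] by (simp add: B.m_assoc[symmetric])
  ultimately show "f ((inv\<^bsub>BijGroup A\<^esub> f \<otimes>\<^bsub>BijGroup A\<^esub> g) z) = g z"
    using BijGroup_mult_apply[OF assms(1) mem] by metis
qed

definition left_inner_mapping :: "('a, 'b) monoid_scheme \<Rightarrow> 'a \<Rightarrow> 'a \<Rightarrow> 'a \<Rightarrow> 'a"
  where "left_inner_mapping Q x y =
    inv\<^bsub>BijGroup (carrier Q)\<^esub> left_translation Q (y \<otimes>\<^bsub>Q\<^esub> x)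
      \<otimes>\<^bsub>BijGroup (carrier Q)\<^esub> left_translation Q y \<otimes>\<^bsub>BijGroup (carrier Q)\<^esub> left_translation Q x"

definition right_inner_mapping :: "('a, 'b) monoid_scheme \<Rightarrow> 'a \<Rightarrow> 'a \<Rightarrow> 'a \<Rightarrow> 'a"
  where "right_inner_mapping Q x y =
    inv\<^bsub>BijGroup (carrier Q)\<^esub> right_translation Q (x \<otimes>\<^bsub>Q\<^esub> y)
      \<otimes>\<^bsub>BijGroup (carrier Q)\<^esub> right_translation Q y \<otimes>\<^bsub>BijGroup (carrier Q)\<^esub> right_translation Q x"

definition middle_inner_mapping :: "('a, 'b) monoid_scheme \<Rightarrow> 'a \<Rightarrow> 'a \<Rightarrow> 'a"
  where "middle_inner_mapping Q x =
    inv\<^bsub>BijGroup (carrier Q)\<^esub> right_translation Q x \<otimes>\<^bsub>BijGroup (carrier Q)\<^esub> left_translation Q x"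

lemma inner_mapping_generators_eq:
  "inner_mapping_generators Q =
    {left_inner_mapping Q x y | x y. x \<in> carrier Q \<and> y \<in> carrier Q} \<union>
    {right_inner_mapping Q x y | x y. x \<in> carrier Q \<and> y \<in> carrier Q} \<union>
    {middle_inner_mapping Q x | x. x \<in> carrier Q}"
  by (simp add: inner_mapping_generators_def left_inner_mapping_def right_inner_mapping_def
      middle_inner_mapping_def Let_def)

context loop
begin

lemma BijGroup_inv_mult_compose:
  assumes "f \<in> Bij (carrier Q)" "g \<in> Bij (carrier Q)" "h \<in> Bij (carrier Q)"
  shows "inv\<^bsub>BijGroup (carrier Q)\<^esub> f \<otimes>\<^bsub>BijGroup (carrier Q)\<^esub> g \<otimes>\<^bsub>BijGroup (carrier Q)\<^esub> h =
    inv\<^bsub>BijGroup (carrier Q)\<^esub> f \<otimes>\<^bsub>BijGroup (carrier Q)\<^esub> compose (carrier Q) g h"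
proof -
  interpret B: group "BijGroup (carrier Q)" by (rule group_BijGroup)
  have carr: "carrier (BijGroup (carrier Q)) = Bij (carrier Q)" by (simp add: BijGroup_def)
  have "compose (carrier Q) g h = g \<otimes>\<^bsub>BijGroup (carrier Q)\<^esub> h"
    using assms by (simp add: BijGroup_def)
  then show ?thesis using assms[folded carr] by (simp add: B.m_assoc)
qed

lemma middle_inner_mapping:
  assumes "x \<in> carrier Q"
  shows "middle_inner_mapping Q x \<in> Bij (carrier Q)"
    and "z \<in> carrier Q \<Longrightarrow> middle_inner_mapping Q x z \<otimes> x = x \<otimes> z"
proof -
  note B = BijGroup_inv_mult[OF right_translation_Bij[OF assms] left_translation_Bij[OF assms]]
  show mem: "middle_inner_mapping Q x \<in> Bij (carrier Q)"
    using B(1) by (simp add: middle_inner_mapping_def)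
  assume z: "z \<in> carrier Q"
  then have "middle_inner_mapping Q x z \<in> carrier Q"
    using mem Bij_imp_funcset by blast
  then show "middle_inner_mapping Q x z \<otimes> x = x \<otimes> z"
    using B(2)[OF z, folded middle_inner_mapping_def] z
    by (simp add: left_translation_def right_translation_def)
qed

lemma left_inner_mapping:
  assumes "x \<in> carrier Q" "y \<in> carrier Q"
  shows "left_inner_mapping Q x y \<in> Bij (carrier Q)"
    and "z \<in> carrier Q \<Longrightarrow> (y \<otimes> x) \<otimes> left_inner_mapping Q x y z = y \<otimes> (x \<otimes> z)"
proof -
  note L = left_translation_Bij
  note eq = BijGroup_inv_mult_compose[OF L[OF m_closed[OF assms(2,1)]] L[OF assms(2)] L[OF assms(1)],
      folded left_inner_mapping_def]
  note B = BijGroup_inv_mult[OF L[OF m_closed[OF assms(2,1)]]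
      compose_Bij[OF L[OF assms(2)] L[OF assms(1)]], folded eq]
  show mem: "left_inner_mapping Q x y \<in> Bij (carrier Q)" by (rule B(1))
  assume z: "z \<in> carrier Q"
  then have "left_inner_mapping Q x y z \<in> carrier Q"
    using mem Bij_imp_funcset by blast
  then show "(y \<otimes> x) \<otimes> left_inner_mapping Q x y z = y \<otimes> (x \<otimes> z)"
    using B(2)[OF z] z assms m_closed by (simp add: compose_eq left_translation_def)
qed

lemma right_inner_mapping:
  assumes "x \<in> carrier Q" "y \<in> carrier Q"
  shows "right_inner_mapping Q x y \<in> Bij (carrier Q)"
    and "z \<in> carrier Q \<Longrightarrow> right_inner_mapping Q x y z \<otimes> (x \<otimes> y) = (z \<otimes> x) \<otimes> y"
proof -
  note R = right_translation_Bij
  note eq = BijGroup_inv_mult_compose[OF R[OF m_closed[OF assms]] R[OF assms(2)] R[OF assms(1)],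
      folded right_inner_mapping_def]
  note B = BijGroup_inv_mult[OF R[OF m_closed[OF assms]]
      compose_Bij[OF R[OF assms(2)] R[OF assms(1)]], folded eq]
  show mem: "right_inner_mapping Q x y \<in> Bij (carrier Q)" by (rule B(1))
  assume z: "z \<in> carrier Q"
  then have "right_inner_mapping Q x y z \<in> carrier Q"
    using mem Bij_imp_funcset by blast
  then show "right_inner_mapping Q x y z \<otimes> (x \<otimes> y) = (z \<otimes> x) \<otimes> y"
    using B(2)[OF z] z assms m_closed by (simp add: compose_eq right_translation_def)
qed

lemma inner_mapping_generators_Bij: "inner_mapping_generators Q \<subseteq> Bij (carrier Q)"
  using middle_inner_mapping(1) left_inner_mapping(1) right_inner_mapping(1)
  by (auto simp: inner_mapping_generators_eq)

lemma comm_group_Inn_iff: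
  "comm_group (Inn Q) \<longleftrightarrow>
    (\<forall>f \<in> inner_mapping_generators Q. \<forall>g \<in> inner_mapping_generators Q.
      \<forall>z \<in> carrier Q. f (g z) = g (f z))"
proof -
  have "inner_mapping_generators Q \<subseteq> carrier (BijGroup (carrier Q))"
    using inner_mapping_generators_Bij by (simp add: BijGroup_def)
  then have "comm_group (Inn Q) \<longleftrightarrow>
    (\<forall>f \<in> inner_mapping_generators Q. \<forall>g \<in> inner_mapping_generators Q.
      f \<otimes>\<^bsub>BijGroup (carrier Q)\<^esub> g = g \<otimes>\<^bsub>BijGroup (carrier Q)\<^esub> f)"
    unfolding Inn_def by (rule group.comm_group_subgroup_generated_iff[OF group_BijGroup])
  also have "\<dots> \<longleftrightarrow>
    (\<forall>f \<in> inner_mapping_generators Q. \<forall>g \<in> inner_mapping_generators Q.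
      \<forall>z \<in> carrier Q. f (g z) = g (f z))"
    using inner_mapping_generators_Bij by (intro ball_cong refl BijGroup_commute_iff) auto
  finally show ?thesis .
qed

lemma right_cancel_eq:
  "\<lbrakk>a \<otimes> x = b \<otimes> x; a \<in> carrier Q; b \<in> carrier Q; x \<in> carrier Q\<rbrakk> \<Longrightarrow> a = b"
  using r_div[of x "b \<otimes> x"] m_closed[of b x] by blast

lemma left_cancel_eq:
  "\<lbrakk>x \<otimes> a = x \<otimes> b; a \<in> carrier Q; b \<in> carrier Q; x \<in> carrier Q\<rbrakk> \<Longrightarrow> a = b"
  using l_div[of x "x \<otimes> b"] m_closed[of x b] by blast

end

section \<open>Central modifications that are bimultiplicative along N\<close>

locale central_modification = group G for G :: "('a, 'b) monoid_scheme" (structure) +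
  fixes Z K N :: "'a set" and \<mu> :: "'a set \<Rightarrow> 'a set \<Rightarrow> 'a"
  assumes Z_subgroup: "subgroup Z G" and Z_le_K: "Z \<subseteq> K" and K_le_N: "K \<subseteq> N"
    and N_normal: "N \<lhd> G" and K_normal: "K \<lhd> G"
    and G_Mod_N_abelian: "comm_group (G Mod N)"
    and Z_central: "Z \<subseteq> group_center G"
    and N_Mod_K_central: "carrier ((G\<lparr>carrier := N\<rparr>) Mod K) \<subseteq> group_center (G Mod K)"
    and \<mu>_in_Z: "\<And>A B. \<lbrakk>A \<in> carrier (G Mod K); B \<in> carrier (G Mod K)\<rbrakk> \<Longrightarrow> \<mu> A B \<in> Z"
    and \<mu>_one: "\<And>x. x \<in> carrier G \<Longrightarrow> \<mu> (x <# K) K = \<one> \<and> \<mu> K (x <# K) = \<one>"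
    and \<mu>_bimult: "\<And>x y z. \<lbrakk>x \<in> carrier G; y \<in> carrier G; z \<in> carrier G; {x, y, z} \<inter> N \<noteq> {}\<rbrakk> \<Longrightarrow>
      lift_cosets G K \<mu> (x \<otimes> y) z = lift_cosets G K \<mu> x z \<otimes> lift_cosets G K \<mu> y z \<and>
      lift_cosets G K \<mu> x (y \<otimes> z) = lift_cosets G K \<mu> x y \<otimes> lift_cosets G K \<mu> x z"
begin

interpretation Z: subgroup Z G by (rule Z_subgroup)
interpretation K: normal K G by (rule K_normal)
interpretation N: normal N G by (rule N_normal)

abbreviation m :: "'a \<Rightarrow> 'a \<Rightarrow> 'a" where "m \<equiv> lift_cosets G K \<mu>"
abbreviation \<delta> :: "'a \<Rightarrow> 'a \<Rightarrow> 'a" where "\<delta> \<equiv> lift_delta G K \<mu>"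
abbreviation conj :: "'a \<Rightarrow> 'a \<Rightarrow> 'a" where "conj \<equiv> conjugate_by G"
abbreviation comm :: "'a \<Rightarrow> 'a \<Rightarrow> 'a" where "comm \<equiv> group_commutator G"
abbreviation Q :: "'a monoid" where "Q \<equiv> modified_loop G K \<mu>"

lemma K_le_G: "k \<in> K \<Longrightarrow> k \<in> carrier G" using K.subset by blast
lemma N_le_G: "n \<in> N \<Longrightarrow> n \<in> carrier G" using N.subset by blast
lemma Z_le_G: "c \<in> Z \<Longrightarrow> c \<in> carrier G" using Z.subset by blast
lemma Z_le_N: "c \<in> Z \<Longrightarrow> c \<in> N" using Z_le_K K_le_N by blast

lemma Z_commutes:
  assumes "c \<in> Z" "g \<in> carrier G"
  shows "c \<otimes> g = g \<otimes> c"
  using Z_central assms by (auto simp: group_center_def)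

text \<open>Ordered rewriting can only swap a pair in the direction that decreases the term, and only
  one of the two factors may be known to be central, hence the symmetric copies.\<close>

lemma Z_ac:
  assumes "c \<in> Z" "g \<in> carrier G"
  shows "c \<otimes> g = g \<otimes> c" "g \<otimes> c = c \<otimes> g"
    and "h \<in> carrier G \<Longrightarrow> c \<otimes> (g \<otimes> h) = g \<otimes> (c \<otimes> h)"
    and "h \<in> carrier G \<Longrightarrow> g \<otimes> (c \<otimes> h) = c \<otimes> (g \<otimes> h)"
proof -
  show "c \<otimes> g = g \<otimes> c" "g \<otimes> c = c \<otimes> g" using Z_commutes[OF assms] by simp_all
  assume "h \<in> carrier G"
  then show "c \<otimes> (g \<otimes> h) = g \<otimes> (c \<otimes> h)" "g \<otimes> (c \<otimes> h) = c \<otimes> (g \<otimes> h)"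
    using Z_commutes[OF assms] assms Z_le_G by (metis m_assoc)+
qed

lemma mult_inv_cancel:
  assumes "x \<in> carrier G" "y \<in> carrier G"
  shows "inv x \<otimes> (x \<otimes> y) = y" "x \<otimes> (inv x \<otimes> y) = y"
  using assms by (simp_all add: m_assoc[symmetric])

text \<open>Here \<open>e\<close> will be what an element of \<open>N\<close> contributes to \<open>c\<close> in \<open>z \<mapsto> z c(z)\<close>.\<close>

lemma mult_inv_cancel_right:
  "\<lbrakk>a \<in> carrier G; e \<in> carrier G; p \<in> carrier G\<rbrakk> \<Longrightarrow> a \<otimes> e \<otimes> inv (p \<otimes> e) = a \<otimes> inv p"
  by (simp add: inv_mult_group m_assoc mult_inv_cancel)

lemma loop_Q: "loop Q"
  using loop_modified_loop[OF is_group Z_subgroup Z_le_K K_normal Z_central \<mu>_in_Z \<mu>_one] .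

lemma carrier_Q [simp]: "carrier Q = carrier G"
  by (simp add: modified_loop_def)

lemma mult_Q: "x \<otimes>\<^bsub>Q\<^esub> y = x \<otimes> y \<otimes> m x y"
  by (simp add: modified_loop_def)

subsection \<open>The modifying map\<close>

lemma m_in_Z [simp]: "\<lbrakk>x \<in> carrier G; y \<in> carrier G\<rbrakk> \<Longrightarrow> m x y \<in> Z"
  unfolding lift_cosets_def using K.coset_eq by (intro \<mu>_in_Z) (auto simp: FactGroup_def RCOSETS_def)

lemma m_closed_G [simp]: "\<lbrakk>x \<in> carrier G; y \<in> carrier G\<rbrakk> \<Longrightarrow> m x y \<in> carrier G"
  using m_in_Z Z_le_G by blast

lemma lcoset_mult_K: "\<lbrakk>x \<in> carrier G; k \<in> K\<rbrakk> \<Longrightarrow> (x \<otimes> k) <# K = x <# K"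
  using lcos_m_assoc[OF K.subset] coset_join3[OF K_le_G K.is_subgroup] K_le_G by metis

lemma m_mult_K [simp]:
  assumes "x \<in> carrier G" "k \<in> K"
  shows "m (x \<otimes> k) y = m x y" "m y (x \<otimes> k) = m y x"
  using lcoset_mult_K[OF assms] by (simp_all add: lift_cosets_def)

lemma m_mult_Z [simp]:
  assumes "x \<in> carrier G" "c \<in> Z"
  shows "m (x \<otimes> c) y = m x y" "m y (x \<otimes> c) = m y x"
  using assms Z_le_K by auto

text \<open>The same invariance for products that \<open>m_assoc\<close> has bracketed to the right.\<close>

lemma m_mult_mult_Z [simp]:
  assumes "x \<in> carrier G" "y \<in> carrier G" "c \<in> Z"
  shows "m (x \<otimes> (y \<otimes> c)) z = m (x \<otimes> y) z" "m z (x \<otimes> (y \<otimes> c)) = m z (x \<otimes> y)"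
  using m_mult_Z[of "x \<otimes> y" c] assms Z_le_G by (simp_all add: m_assoc)

lemma m_one [simp]:
  assumes "x \<in> carrier G"
  shows "m \<one> x = \<one>" "m x \<one> = \<one>"
  using \<mu>_one[OF assms] lcos_mult_one[OF K.subset] by (simp_all add: lift_cosets_def)

lemma m_bimult:
  assumes "x \<in> carrier G" "y \<in> carrier G" "n \<in> N"
  shows "m (x \<otimes> n) y = m x y \<otimes> m n y" "m y (x \<otimes> n) = m y x \<otimes> m y n"
    and "m (x \<otimes> y) n = m x n \<otimes> m y n" "m n (x \<otimes> y) = m n x \<otimes> m n y"
  using \<mu>_bimult[of x n y] \<mu>_bimult[of y x n] \<mu>_bimult[of x y n] \<mu>_bimult[of n x y] assms N_le_G
  by auto

lemma m_inv:
  assumes "x \<in> carrier G" "n \<in> N"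
  shows "m (inv x) n = inv (m x n)" "m n (inv x) = inv (m n x)"
proof -
  have "m (inv x) n \<otimes> m x n = \<one>" "m n (inv x) \<otimes> m n x = \<one>"
    using m_bimult(3,4)[of "inv x" x n, symmetric] assms N_le_G by simp_all
  then show "m (inv x) n = inv (m x n)" "m n (inv x) = inv (m n x)"
    using assms N_le_G by (auto intro!: inv_equality[symmetric])
qed

lemma \<delta>_in_Z [simp]: "\<lbrakk>x \<in> carrier G; y \<in> carrier G\<rbrakk> \<Longrightarrow> \<delta> x y \<in> Z"
  by (simp add: lift_delta_def)

subsection \<open>Conjugates and commutators\<close>

lemma conj_closed [simp]: "\<lbrakk>x \<in> carrier G; y \<in> carrier G\<rbrakk> \<Longrightarrow> conj x y \<in> carrier G"
  by (simp add: conjugate_by_def)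

lemma comm_closed [simp]: "\<lbrakk>x \<in> carrier G; y \<in> carrier G\<rbrakk> \<Longrightarrow> comm x y \<in> carrier G"
  by (simp add: group_commutator_def)

lemma conj_eq: "\<lbrakk>x \<in> carrier G; y \<in> carrier G\<rbrakk> \<Longrightarrow> conj x y = x \<otimes> comm x y"
  by (simp add: group_commutator_def m_assoc[symmetric])

lemma conj_mult:
  "\<lbrakk>a \<in> carrier G; b \<in> carrier G; x \<in> carrier G\<rbrakk> \<Longrightarrow> conj (a \<otimes> b) x = conj a x \<otimes> conj b x"
  by (simp add: conjugate_by_def m_assoc mult_inv_cancel)

lemma conj_conj:
  "\<lbrakk>z \<in> carrier G; x \<in> carrier G; y \<in> carrier G\<rbrakk> \<Longrightarrow> conj (conj z y) x = conj z (y \<otimes> x)"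
  by (simp add: conjugate_by_def m_assoc inv_mult_group)

lemma conj_Z: "\<lbrakk>c \<in> Z; x \<in> carrier G\<rbrakk> \<Longrightarrow> conj c x = c"
  using Z_commutes[of c x] Z_le_G[of c] by (simp add: conjugate_by_def m_assoc mult_inv_cancel)

lemma comm_in_N:
  assumes "x \<in> carrier G" "y \<in> carrier G"
  shows "comm x y \<in> N"
proof -
  have "derived G (carrier G) \<subseteq> N"
    by (rule derived_minimal[OF N_normal G_Mod_N_abelian])
  moreover have "inv x \<otimes> inv y \<otimes> inv (inv x) \<otimes> inv (inv y) \<in> derived G (carrier G)"
    unfolding derived_def using assms inv_closed by (intro generate.incl) blast
  ultimately show ?thesis
    using assms by (auto simp: group_commutator_def conjugate_by_def m_assoc)
qed

text \<open>This is the centrality of \<open>N/K\<close> in \<open>G/K\<close>, with the error term placed on the right,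
  where \<open>\<mu>\<close> ignores it.\<close>

lemma N_commutes_mod_K:
  assumes n: "n \<in> N" and g: "g \<in> carrier G"
  obtains k where "k \<in> K" "n \<otimes> g = g \<otimes> n \<otimes> k"
proof -
  have "K #> n \<in> carrier ((G\<lparr>carrier := N\<rparr>) Mod K)"
    using n by (auto simp: FactGroup_def RCOSETS_def r_coset_def)
  then have "(K #> n) <#> (K #> g) = (K #> g) <#> (K #> n)"
    using N_Mod_K_central g by (auto simp: group_center_def FactGroup_def RCOSETS_def)
  then have "(n \<otimes> g) <# K = (g \<otimes> n) <# K"
    using n g N_le_G K.rcos_sum K.coset_eq by simp
  moreover have "n \<otimes> g \<in> (n \<otimes> g) <# K"
    using n g N_le_G K.one_closed by (force simp: l_coset_def)
  ultimately show thesis using that by (auto simp: l_coset_def)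
qed

lemma comm_in_K:
  assumes n: "n \<in> N" and g: "g \<in> carrier G"
  shows "comm n g \<in> K"
proof -
  obtain k where k: "k \<in> K" "n \<otimes> g = g \<otimes> n \<otimes> k" using N_commutes_mod_K[OF assms] .
  then have "comm n g = k"
    using n g N_le_G K_le_G
    by (simp add: group_commutator_def conjugate_by_def m_assoc mult_inv_cancel)
  with k show ?thesis by simp
qed

subsection \<open>Central shifts\<close>

text \<open>Invariance of \<open>c\<close> is required along \<open>N\<close> and not only along \<open>Z\<close>, because the middle
  inner mappings move elements within their cosets of \<open>N\<close>.\<close>

definition central_shift :: "('a \<Rightarrow> 'a) \<Rightarrow> bool"
  where "central_shift f \<longleftrightarrow> (\<exists>c. \<forall>z \<in> carrier G. c z \<in> Z \<and> f z = z \<otimes> c z \<and>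
    (\<forall>n \<in> N. c (z \<otimes> n) = c z))"

text \<open>Both compositions send \<open>z\<close> to \<open>z c(z) d(z)\<close>, as neither map changes the coset of \<open>N\<close>
  on which the other one depends.\<close>

lemma central_shifts_commute:
  assumes "central_shift f" "central_shift g" "z \<in> carrier G"
  shows "f (g z) = g (f z)"
proof -
  obtain c where c: "\<And>z. z \<in> carrier G \<Longrightarrow> c z \<in> Z \<and> f z = z \<otimes> c z \<and> (\<forall>n \<in> N. c (z \<otimes> n) = c z)"
    using assms(1) unfolding central_shift_def by blast
  obtain d where d: "\<And>z. z \<in> carrier G \<Longrightarrow> d z \<in> Z \<and> g z = z \<otimes> d z \<and> (\<forall>n \<in> N. d (z \<otimes> n) = d z)"
    using assms(2) unfolding central_shift_def by blast
  have cd: "c z \<in> Z" "d z \<in> Z" "c z \<in> N" "d z \<in> N" "c z \<in> carrier G" "d z \<in> carrier G"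
    using c[OF assms(3)] d[OF assms(3)] Z_le_N Z_le_G by auto
  show ?thesis
    using c[of z] d[of z] c[of "z \<otimes> d z"] d[of "z \<otimes> c z"] cd assms(3)
    by (simp add: m_assoc Z_commutes)
qed

text \<open>The shift is obtained by comparing the central factors in \<open>(y * x) * w = y * (x * z)\<close>.\<close>

lemma left_inner_mapping_central_shift:
  assumes x: "x \<in> carrier G" and y: "y \<in> carrier G"
  shows "central_shift (left_inner_mapping Q x y)"
proof -
  interpret Q: loop Q by (rule loop_Q)
  define c where "c z = m x z \<otimes> m y (x \<otimes> z) \<otimes> inv m (y \<otimes> x) z \<otimes> inv m y x" for z
  have cZ: "c z \<in> Z" if "z \<in> carrier G" for z
    using that x y by (simp add: c_def)
  have val: "left_inner_mapping Q x y z = z \<otimes> c z" if z: "z \<in> carrier G" for z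
  proof (rule Q.left_cancel_eq[of "y \<otimes>\<^bsub>Q\<^esub> x"])
    have "c z \<otimes> (m y x \<otimes> m (y \<otimes> x) z) = m x z \<otimes> m y (x \<otimes> z)"
      using x y z by (simp add: c_def m_assoc mult_inv_cancel)
    moreover have "(y \<otimes>\<^bsub>Q\<^esub> x) \<otimes>\<^bsub>Q\<^esub> (z \<otimes> c z) = y \<otimes> x \<otimes> z \<otimes> (c z \<otimes> (m y x \<otimes> m (y \<otimes> x) z))"
      using x y z cZ[OF z] Z_le_G[OF cZ[OF z]] by (simp add: mult_Q m_assoc Z_ac)
    moreover have "y \<otimes>\<^bsub>Q\<^esub> (x \<otimes>\<^bsub>Q\<^esub> z) = y \<otimes> x \<otimes> z \<otimes> (m x z \<otimes> m y (x \<otimes> z))"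
      using x y z by (simp add: mult_Q m_assoc[symmetric])
    ultimately show "(y \<otimes>\<^bsub>Q\<^esub> x) \<otimes>\<^bsub>Q\<^esub> left_inner_mapping Q x y z = (y \<otimes>\<^bsub>Q\<^esub> x) \<otimes>\<^bsub>Q\<^esub> (z \<otimes> c z)"
      using Q.left_inner_mapping(2)[of x y z] x y z by simp
    show "left_inner_mapping Q x y z \<in> carrier Q"
      using Q.left_inner_mapping(1)[of x y] Bij_imp_funcset x y z by fastforce
    show "y \<otimes>\<^bsub>Q\<^esub> x \<in> carrier Q" using Q.m_closed x y by simp
  qed (use z cZ Z_le_G in auto)
  have inv: "c (z \<otimes> n) = c z" if z: "z \<in> carrier G" and n: "n \<in> N" for z n
  proof -
    have nG: "n \<in> carrier G" using n N_le_G by blast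
    \<comment> \<open>Replacing \<open>z\<close> by \<open>zn\<close> multiplies numerator and denominator of \<open>c\<close> by the same factor.\<close>
    let ?e = "m x n \<otimes> m y n"
    have "m x (z \<otimes> n) \<otimes> m y (x \<otimes> (z \<otimes> n)) = m x z \<otimes> m y (x \<otimes> z) \<otimes> ?e"
      using x y z n nG by (simp add: m_assoc[symmetric] m_bimult) (simp add: m_assoc Z_ac)
    moreover have "m (y \<otimes> x) (z \<otimes> n) = m (y \<otimes> x) z \<otimes> ?e"
      using x y z n nG by (simp add: m_bimult Z_commutes)
    ultimately show ?thesis
      using x y z nG by (simp add: c_def mult_inv_cancel_right)
  qed
  show ?thesis
    unfolding central_shift_def using cZ val inv by blast
qed

text \<open>The mirror image, with one extra difficulty: in \<open>\<mu>(znx,y)\<close> the element of \<open>N\<close> stands in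
  the middle and has to be moved past \<open>x\<close> modulo \<open>K\<close>.\<close>

lemma right_inner_mapping_central_shift:
  assumes x: "x \<in> carrier G" and y: "y \<in> carrier G"
  shows "central_shift (right_inner_mapping Q x y)"
proof -
  interpret Q: loop Q by (rule loop_Q)
  define c where "c z = m z x \<otimes> m (z \<otimes> x) y \<otimes> inv m z (x \<otimes> y) \<otimes> inv m x y" for z
  have cZ: "c z \<in> Z" if "z \<in> carrier G" for z
    using that x y by (simp add: c_def)
  have val: "right_inner_mapping Q x y z = z \<otimes> c z" if z: "z \<in> carrier G" for z
  proof (rule Q.right_cancel_eq[of _ "x \<otimes>\<^bsub>Q\<^esub> y"])
    have "c z \<otimes> (m x y \<otimes> m z (x \<otimes> y)) = m z x \<otimes> m (z \<otimes> x) y"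
      using x y z by (simp add: c_def m_assoc mult_inv_cancel)
    moreover have "(z \<otimes> c z) \<otimes>\<^bsub>Q\<^esub> (x \<otimes>\<^bsub>Q\<^esub> y) = z \<otimes> x \<otimes> y \<otimes> (c z \<otimes> (m x y \<otimes> m z (x \<otimes> y)))"
      using x y z cZ[OF z] Z_le_G[OF cZ[OF z]] by (simp add: mult_Q m_assoc Z_ac)
    moreover have "(z \<otimes>\<^bsub>Q\<^esub> x) \<otimes>\<^bsub>Q\<^esub> y = z \<otimes> x \<otimes> y \<otimes> (m z x \<otimes> m (z \<otimes> x) y)"
      using x y z by (simp add: mult_Q m_assoc Z_ac)
    ultimately show "right_inner_mapping Q x y z \<otimes>\<^bsub>Q\<^esub> (x \<otimes>\<^bsub>Q\<^esub> y) = (z \<otimes> c z) \<otimes>\<^bsub>Q\<^esub> (x \<otimes>\<^bsub>Q\<^esub> y)"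
      using Q.right_inner_mapping(2)[of x y z] x y z by simp
    show "right_inner_mapping Q x y z \<in> carrier Q"
      using Q.right_inner_mapping(1)[of x y] Bij_imp_funcset x y z by fastforce
    show "x \<otimes>\<^bsub>Q\<^esub> y \<in> carrier Q" using Q.m_closed x y by simp
  qed (use z cZ Z_le_G in auto)
  have inv: "c (z \<otimes> n) = c z" if z: "z \<in> carrier G" and n: "n \<in> N" for z n
  proof -
    have nG: "n \<in> carrier G" using n N_le_G by blast
    obtain k where k: "k \<in> K" "n \<otimes> x = x \<otimes> n \<otimes> k" using N_commutes_mod_K[OF n x] .
    have "m (z \<otimes> n \<otimes> x) y = m (z \<otimes> x \<otimes> n \<otimes> k) y"
      using x z nG k K_le_G by (simp add: m_assoc)
    also have "\<dots> = m (z \<otimes> x) y \<otimes> m n y"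
      using x y z n nG k by (simp add: m_bimult)
    finally have zxn: "m (z \<otimes> n \<otimes> x) y = m (z \<otimes> x) y \<otimes> m n y" .
    let ?e = "m n x \<otimes> m n y"
    have "m (z \<otimes> n) x \<otimes> m (z \<otimes> n \<otimes> x) y = m z x \<otimes> m (z \<otimes> x) y \<otimes> ?e"
      using x y z n nG by (simp add: zxn m_bimult) (simp add: m_assoc Z_ac)
    moreover have "m (z \<otimes> n) (x \<otimes> y) = m z (x \<otimes> y) \<otimes> ?e"
      using x y z n nG by (simp add: m_bimult)
    ultimately show ?thesis
      using x y z nG by (simp add: c_def mult_inv_cancel_right)
  qed
  show ?thesis
    unfolding central_shift_def using cZ val inv by blast
qed

subsection \<open>Middle inner mappings\<close>

text \<open>The central factor by which the middle inner mapping at \<open>x\<^sup>-\<^sup>1\<close> differs from conjugation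
  by \<open>x\<close>. The parameter is inverted so that \<open>z\<^sup>x\<close> appears instead of conjugation by \<open>x\<^sup>-\<^sup>1\<close>;
  as \<open>x\<close> runs through \<open>G\<close>, all middle inner mappings are still obtained.\<close>

definition twist :: "'a \<Rightarrow> 'a \<Rightarrow> 'a"
  where "twist x z = m (inv x) z \<otimes> inv m (conj z x) (inv x)"

lemma twist_in_Z [simp]: "\<lbrakk>x \<in> carrier G; z \<in> carrier G\<rbrakk> \<Longrightarrow> twist x z \<in> Z"
  by (simp add: twist_def)

lemma twist_closed [simp]: "\<lbrakk>x \<in> carrier G; z \<in> carrier G\<rbrakk> \<Longrightarrow> twist x z \<in> carrier G"
  using twist_in_Z Z_le_G by blast

lemma twist_mult_Z:
  assumes "x \<in> carrier G" "z \<in> carrier G" "c \<in> Z"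
  shows "twist x (z \<otimes> c) = twist x z"
  using assms Z_le_G by (simp add: twist_def conj_mult conj_Z)

lemma middle_inner_mapping_inv:
  assumes x: "x \<in> carrier G" and z: "z \<in> carrier G"
  shows "middle_inner_mapping Q (inv x) z = conj z x \<otimes> twist x z"
proof -
  interpret Q: loop Q by (rule loop_Q)
  show ?thesis
  proof (rule Q.right_cancel_eq[of _ "inv x"])
    have "(conj z x \<otimes> twist x z) \<otimes>\<^bsub>Q\<^esub> inv x = conj z x \<otimes> inv x \<otimes> (twist x z \<otimes> m (conj z x) (inv x))"
      using x z by (simp add: mult_Q m_assoc Z_ac)
    also have "\<dots> = inv x \<otimes>\<^bsub>Q\<^esub> z"
      using x z by (simp add: mult_Q twist_def m_assoc conjugate_by_def)
    finally show "middle_inner_mapping Q (inv x) z \<otimes>\<^bsub>Q\<^esub> inv x = (conj z x \<otimes> twist x z) \<otimes>\<^bsub>Q\<^esub> inv x"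
      using Q.middle_inner_mapping(2)[of "inv x" z] x z by simp
    show "middle_inner_mapping Q (inv x) z \<in> carrier Q"
      using Q.middle_inner_mapping(1)[of "inv x"] Bij_imp_funcset x z by fastforce
  qed (use x z in auto)
qed

text \<open>Modulo \<open>K\<close> one has \<open>(zn)\<^sup>x = z\<^sup>x n\<close>, so \<open>n\<close> contributes the factors
  \<open>\<mu>(x\<^sup>-\<^sup>1,n) = \<mu>(x,n)\<^sup>-\<^sup>1\<close> and \<open>\<mu>(n,x\<^sup>-\<^sup>1)\<^sup>-\<^sup>1 = \<mu>(n,x)\<close>. This is where \<open>\<delta>\<close> comes from.\<close>

lemma twist_mult_N:
  assumes x: "x \<in> carrier G" and z: "z \<in> carrier G" and n: "n \<in> N"
  shows "twist x (z \<otimes> n) = twist x z \<otimes> \<delta> n x"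
proof -
  have nG: "n \<in> carrier G" using n N_le_G by blast
  have k: "comm n x \<in> K" using comm_in_K n x by blast
  have "conj (z \<otimes> n) x = conj z x \<otimes> n \<otimes> comm n x"
    using x z nG by (simp add: conj_mult conj_eq[of n x] m_assoc)
  then have "m (conj (z \<otimes> n) x) (inv x) = m (conj z x) (inv x) \<otimes> inv (m n x)"
    using x z n nG k by (simp add: m_bimult m_inv)
  then show ?thesis
    using x z n nG by (simp add: twist_def lift_delta_def m_bimult m_inv inv_mult_group m_assoc Z_ac)
qed

text \<open>The middle inner mapping preserves the coset \<open>zN\<close>, on which the shift is constant, and the
  shift preserves \<open>zZ\<close>, on which the twist is constant.\<close>

lemma central_shift_commutes_middle:
  assumes f: "central_shift f" and x: "x \<in> carrier G" and z: "z \<in> carrier G"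
  shows "f (middle_inner_mapping Q (inv x) z) = middle_inner_mapping Q (inv x) (f z)"
proof -
  obtain c where c: "\<And>z. z \<in> carrier G \<Longrightarrow> c z \<in> Z \<and> f z = z \<otimes> c z \<and> (\<forall>n \<in> N. c (z \<otimes> n) = c z)"
    using f unfolding central_shift_def by blast
  have cz: "c z \<in> Z" "c z \<in> N" "c z \<in> carrier G" using c[OF z] Z_le_N Z_le_G by auto
  have n: "comm z x \<otimes> twist x z \<in> N"
    using x z comm_in_N twist_in_Z[OF x z] Z_le_N by blast
  have "conj z x \<otimes> twist x z = z \<otimes> (comm z x \<otimes> twist x z)"
    using x z by (simp add: conj_eq m_assoc)
  then have "c (conj z x \<otimes> twist x z) = c z" using c z n by metis
  then have "f (conj z x \<otimes> twist x z) = conj z x \<otimes> twist x z \<otimes> c z"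
    using c x z by simp
  moreover have "twist x (z \<otimes> c z) = twist x z"
    using twist_mult_Z x z cz by blast
  ultimately show ?thesis
    using x z cz c[OF z] by (simp add: middle_inner_mapping_inv conj_mult conj_Z m_assoc Z_commutes)
qed

text \<open>The twist at \<open>z\<^sup>y = z [z,y]\<close> is split by \<open>twist_mult_N\<close>; the product is arranged so that
  its last factor is symmetric in \<open>x\<close> and \<open>y\<close>.\<close>

lemma middle_inner_mapping_comp:
  assumes x: "x \<in> carrier G" and y: "y \<in> carrier G" and z: "z \<in> carrier G"
  shows "middle_inner_mapping Q (inv x) (middle_inner_mapping Q (inv y) z) =
    conj z (y \<otimes> x) \<otimes> \<delta> (comm z y) x \<otimes> (twist x z \<otimes> twist y z)"
proof -
  have n: "comm z y \<in> N" using comm_in_N y z by blast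
  have t: "twist y z \<in> Z" "twist y z \<in> N" "twist y z \<in> carrier G"
    using y z twist_in_Z[OF y z] Z_le_N by simp_all
  have dx: "\<delta> (comm z y) x \<in> Z" "\<delta> (comm z y) x \<in> carrier G" using x y z Z_le_G by auto
  have "twist x (conj z y \<otimes> twist y z) = twist x (conj z y)"
    using twist_mult_Z x y z by simp
  also have "\<dots> = twist x z \<otimes> \<delta> (comm z y) x"
    using twist_mult_N[OF x z n] conj_eq[OF z y] by simp
  finally show ?thesis
    using x y z t dx
    by (simp add: middle_inner_mapping_inv conj_mult conj_Z conj_conj m_assoc Z_ac)
qed

lemma middle_inner_mappings_commute_iff:
  assumes x: "x \<in> carrier G" and y: "y \<in> carrier G" and z: "z \<in> carrier G"
  shows "middle_inner_mapping Q (inv x) (middle_inner_mapping Q (inv y) z) =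
      middle_inner_mapping Q (inv y) (middle_inner_mapping Q (inv x) z) \<longleftrightarrow>
    conj z (y \<otimes> x) \<otimes> \<delta> (comm z y) x = conj z (x \<otimes> y) \<otimes> \<delta> (comm z x) y"
proof -
  have "\<delta> (comm z y) x \<in> carrier G" "\<delta> (comm z x) y \<in> carrier G" using x y z Z_le_G by auto
  moreover have "twist y z \<otimes> twist x z = twist x z \<otimes> twist y z" using x y z by (simp add: Z_commutes)
  ultimately show ?thesis
    using middle_inner_mapping_comp[OF x y z] middle_inner_mapping_comp[OF y x z] x y z
    by simp
qed

theorem comm_group_Inn_Q_iff:
  "comm_group (Inn Q) \<longleftrightarrow>
    (\<forall>x \<in> carrier G. \<forall>y \<in> carrier G. \<forall>z \<in> carrier G.
      conj z (y \<otimes> x) \<otimes> \<delta> (comm z y) x = conj z (x \<otimes> y) \<otimes> \<delta> (comm z x) y)"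
proof -
  interpret Q: loop Q by (rule loop_Q)
  let ?M = "\<lambda>x. middle_inner_mapping Q (inv x)"
  have middle: "\<exists>y \<in> carrier G. middle_inner_mapping Q x = ?M y" if "x \<in> carrier G" for x
    using that inv_inv inv_closed by metis
  have gen: "central_shift f \<or> (\<exists>x \<in> carrier G. f = ?M x)"
    if "f \<in> inner_mapping_generators Q" for f
    using that left_inner_mapping_central_shift right_inner_mapping_central_shift middle
    unfolding inner_mapping_generators_eq by auto
  have M: "?M x \<in> inner_mapping_generators Q" if "x \<in> carrier G" for x
    using that unfolding inner_mapping_generators_eq by auto
  have "comm_group (Inn Q) \<longleftrightarrow>
    (\<forall>x \<in> carrier G. \<forall>y \<in> carrier G. \<forall>z \<in> carrier G. ?M x (?M y z) = ?M y (?M x z))"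
    unfolding Q.comm_group_Inn_iff
  proof (intro iffI ballI)
    fix f g z
    assume MM: "\<forall>x \<in> carrier G. \<forall>y \<in> carrier G. \<forall>z \<in> carrier G. ?M x (?M y z) = ?M y (?M x z)"
      and f: "f \<in> inner_mapping_generators Q" and g: "g \<in> inner_mapping_generators Q"
      and z: "z \<in> carrier Q"
    from gen[OF f] gen[OF g] show "f (g z) = g (f z)"
      using MM z central_shifts_commute central_shift_commutes_middle by auto
  qed (use M in auto)
  also have "\<dots> \<longleftrightarrow> (\<forall>x \<in> carrier G. \<forall>y \<in> carrier G. \<forall>z \<in> carrier G.
      conj z (y \<otimes> x) \<otimes> \<delta> (comm z y) x = conj z (x \<otimes> y) \<otimes> \<delta> (comm z x) y)"
    by (intro ball_cong refl middle_inner_mappings_commute_iff)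
  finally show ?thesis .
qed

end

theorem proposition4p6:
  fixes G :: "('a, 'b) monoid_scheme" (structure)
    and Z K N :: "'a set"
    and \<mu> :: "'a set \<Rightarrow> 'a set \<Rightarrow> 'a"
  assumes "group G"
    and "subgroup Z G" and "Z \<subseteq> K" and "K \<subseteq> N"
    and "N \<lhd> G" and "K \<lhd> G"
    and "comm_group (G\<lparr>carrier := N\<rparr>)"
    and "comm_group (G Mod N)"
    and "Z \<subseteq> group_center G"
    and "carrier ((G\<lparr>carrier := N\<rparr>) Mod K) \<subseteq> group_center (G Mod K)"
    and "\<And>A B. \<lbrakk>A \<in> carrier (G Mod K); B \<in> carrier (G Mod K)\<rbrakk> \<Longrightarrow> \<mu> A B \<in> Z"
    and "\<And>x. x \<in> carrier G \<Longrightarrow> \<mu> (x <# K) K = \<one> \<and> \<mu> K (x <# K) = \<one>"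
    and "\<And>x y z. \<lbrakk>x \<in> carrier G; y \<in> carrier G; z \<in> carrier G; {x, y, z} \<inter> N \<noteq> {}\<rbrakk> \<Longrightarrow>
           lift_cosets G K \<mu> (x \<otimes> y) z = lift_cosets G K \<mu> x z \<otimes> lift_cosets G K \<mu> y z \<and>
           lift_cosets G K \<mu> x (y \<otimes> z) = lift_cosets G K \<mu> x y \<otimes> lift_cosets G K \<mu> x z"
  shows "comm_group (Inn (modified_loop G K \<mu>)) \<longleftrightarrow>
    (\<forall>x \<in> carrier G. \<forall>y \<in> carrier G. \<forall>z \<in> carrier G.
      conjugate_by G z (y \<otimes> x) \<otimes> lift_delta G K \<mu> (group_commutator G z y) x =
      conjugate_by G z (x \<otimes> y) \<otimes> lift_delta G K \<mu> (group_commutator G z x) y)"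
proof -
  interpret group G by fact
  interpret central_modification G Z K N \<mu>
    by (intro central_modification.intro central_modification_axioms.intro) fact+
  show ?thesis by (rule comm_group_Inn_Q_iff)
qed

end
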